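(* Every (sufficiently smooth) solution $F:[0,T)\times M\to\mathbb{R}^{n+1}$ of the hyperbolic mean curvature flow (HMCF) satisfies the balance law $$\frac{d}{dt}\left(\left\langle\frac{dF}{dt},F\right\rangle d\mu\right)=\nabla^k\big((n-e)\langle F,F_k\rangle\big)\,d\mu+\big((n+2)\,e-n(n+1)\big)\,d\mu.$$
   Context: $M$ is an orientable smooth $n$-dimensional manifold and $F:[0,T)\times M\to\mathbb{R}^{n+1}$ is a smooth family of immersions. $\frac{d}{dt}$ is the time derivative at a fixed point of $M$ (also applied to time-dependent $n$-forms on $M$); in local coordinates $F_i:=\partial F/\partial x^i$; $g_{ij}:=\langle F_i,F_j\rangle$ is the induced metric, with Levi-Civita connection $\nabla$ and (time-dependent) volume form $d\mu=d\mu_t$; indices are raised with $g^{ij}$. $\nu$ is the unit normal along the hypersurface (inward pointing when $M$ is compact without boundary), $h_{ij}:=-\langle F_i,\nabla_j\nu\rangle$, $H:=g^{ij}h_{ij}$. $\sigma:=\langle\frac{dF}{dt},\nu\rangle$, $S_i:=\langle\frac{dF}{dt},F_i\rangle$, $d^\dagger S:=\nabla^iS_i$, $e:=\frac12\left(\left|\frac{dF}{dt}\right|^2+n\right)$. The equation (HMCF) is $$\frac{d^2}{dt^2}F=\big((e-|S|^2)H-\sigma\,d^\dagger S\big)\nu+\big((\sigma H-d^\dagger S)S^k-\nabla^ke\big)F_k.$$ *)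

theory Defs
  imports "HOL-Analysis.Analysis"
begin

section \<open>Functions of class \<open>C\<^sup>k\<close>\<close>

text \<open>
  Derivatives are taken within \<open>D\<close>. The definition is used for open \<open>D\<close>, and for
  \<open>D = [0,T) \<times> V\<close> with \<open>V\<close> open, where it means one-sided time derivatives at \<open>0\<close>.
  In both cases the derivative within \<open>D\<close> is unique.
\<close>

primrec Ck_on_nat :: "nat \<Rightarrow> 'a::euclidean_space set \<Rightarrow> ('a \<Rightarrow> 'b::real_normed_vector) \<Rightarrow> bool" where
  "Ck_on_nat 0 D f \<longleftrightarrow> continuous_on D f"
| "Ck_on_nat (Suc k) D f \<longleftrightarrow>
     (\<exists>f'. (\<forall>x\<in>D. (f has_derivative f' x) (at x within D)) \<and>
           (\<forall>v. Ck_on_nat k D (\<lambda>x. f' x v)))"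

definition Ck_on :: "enat \<Rightarrow> 'a::euclidean_space set \<Rightarrow> ('a \<Rightarrow> 'b::real_normed_vector) \<Rightarrow> bool" where
  "Ck_on k D f \<longleftrightarrow> (\<forall>j::nat. enat j \<le> k \<longrightarrow> Ck_on_nat j D f)"


section \<open>Smooth and oriented manifolds\<close>

text \<open>A chart is a pair \<open>(U, \<phi>)\<close>; the values of \<open>\<phi>\<close> outside \<open>U\<close> are irrelevant.\<close>

type_synonym ('a, 'n) chart = "'a set \<times> ('a \<Rightarrow> real^'n)"

definition chart_dom :: "('a, 'n::finite) chart \<Rightarrow> 'a set" where
  "chart_dom c = fst c"

definition coord :: "('a, 'n::finite) chart \<Rightarrow> 'a \<Rightarrow> real^'n" where
  "coord c = snd c"

definition chart_inv :: "('a, 'n::finite) chart \<Rightarrow> real^'n \<Rightarrow> 'a" where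
  "chart_inv c = inv_into (chart_dom c) (coord c)"

definition is_chart :: "'a topology \<Rightarrow> ('a, 'n::finite) chart \<Rightarrow> bool" where
  "is_chart M c \<longleftrightarrow>
     openin M (chart_dom c) \<and> open (coord c ` chart_dom c) \<and>
     homeomorphic_map (subtopology M (chart_dom c)) (top_of_set (coord c ` chart_dom c)) (coord c)"

definition transition :: "('a, 'n::finite) chart \<Rightarrow> ('a, 'n) chart \<Rightarrow> real^'n \<Rightarrow> real^'n" where
  "transition c d = coord d \<circ> chart_inv c"

definition smoothly_compatible :: "('a, 'n::finite) chart \<Rightarrow> ('a, 'n) chart \<Rightarrow> bool" where
  "smoothly_compatible c d \<longleftrightarrow>
     Ck_on \<infinity> (coord c ` (chart_dom c \<inter> chart_dom d)) (transition c d) \<and>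
     Ck_on \<infinity> (coord d ` (chart_dom c \<inter> chart_dom d)) (transition d c)"

definition smooth_manifold :: "'a topology \<Rightarrow> ('a, 'n::finite) chart set \<Rightarrow> bool" where
  "smooth_manifold M A \<longleftrightarrow>
     Hausdorff_space M \<and> second_countable M \<and>
     (\<forall>c\<in>A. is_chart M c) \<and> topspace M = (\<Union>c\<in>A. chart_dom c) \<and>
     (\<forall>c\<in>A. \<forall>d\<in>A. smoothly_compatible c d) \<and>
     (\<forall>d. is_chart M d \<and> (\<forall>c\<in>A. smoothly_compatible c d) \<longrightarrow> d \<in> A)"

text \<open>
  An orientation is given by an oriented subatlas of the (maximal) smooth atlas; since that
  atlas is maximal, the manifold is orientable iff such a subatlas exists.
\<close>

definition orientation :: "'a topology \<Rightarrow> ('a, 'n::finite) chart set \<Rightarrow> ('a, 'n) chart set \<Rightarrow> bool" where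
  "orientation M A Ori \<longleftrightarrow>
     Ori \<subseteq> A \<and> topspace M = (\<Union>c\<in>Ori. chart_dom c) \<and>
     (\<forall>c\<in>Ori. \<forall>d\<in>Ori. \<forall>x \<in> coord c ` (chart_dom c \<inter> chart_dom d).
        det (matrix (frechet_derivative (transition c d) (at x))) > 0)"


section \<open>Local geometry of an immersion\<close>

text \<open>
  All tensors are given by their components in a chart \<open>c\<close> at a point \<open>p\<close> of its domain;
  \<open>partial c i f p\<close> is \<open>\<partial>f/\<partial>x\<^sup>i\<close>.
\<close>

definition partial :: "('a, 'n::finite) chart \<Rightarrow> 'n \<Rightarrow> ('a \<Rightarrow> 'b::real_normed_vector) \<Rightarrow> 'a \<Rightarrow> 'b" where
  "partial c i f p =
     vector_derivative (\<lambda>s. f (chart_inv c (coord c p + s *\<^sub>R axis i 1))) (at 0)"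

definition metric :: "('a, 'n::finite) chart \<Rightarrow> ('a \<Rightarrow> real^'m::finite) \<Rightarrow> 'a \<Rightarrow> real^'n^'n" where
  "metric c f p = (\<chi> i j. partial c i f p \<bullet> partial c j f p)"

definition metric_inv :: "('a, 'n::finite) chart \<Rightarrow> ('a \<Rightarrow> real^'m::finite) \<Rightarrow> 'a \<Rightarrow> real^'n^'n" where
  "metric_inv c f p = matrix_inv (metric c f p)"

text \<open>\<open>christoffel c f k i j\<close> is \<open>\<Gamma>\<^sup>k\<^sub>i\<^sub>j\<close>.\<close>

definition christoffel ::
    "('a, 'n::finite) chart \<Rightarrow> ('a \<Rightarrow> real^'m::finite) \<Rightarrow> 'n \<Rightarrow> 'n \<Rightarrow> 'n \<Rightarrow> 'a \<Rightarrow> real" where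
  "christoffel c f k i j p =
     1/2 * (\<Sum>l\<in>UNIV. metric_inv c f p $ k $ l *
        (partial c i (\<lambda>q. metric c f q $ j $ l) p
         + partial c j (\<lambda>q. metric c f q $ i $ l) p
         - partial c l (\<lambda>q. metric c f q $ i $ j) p))"

text \<open>\<open>cov_deriv c f w i j\<close> is \<open>\<nabla>\<^sub>i w\<^sub>j\<close> for a covector field \<open>w\<close>.\<close>

definition cov_deriv ::
    "('a, 'n::finite) chart \<Rightarrow> ('a \<Rightarrow> real^'m::finite) \<Rightarrow> ('a \<Rightarrow> real^'n) \<Rightarrow> 'n \<Rightarrow> 'n \<Rightarrow> 'a \<Rightarrow> real" where
  "cov_deriv c f w i j p =
     partial c i (\<lambda>q. w q $ j) p - (\<Sum>k\<in>UNIV. christoffel c f k i j p * w p $ k)"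

text \<open>\<open>\<nabla>\<^sup>i w\<^sub>i\<close>\<close>

definition divergence ::
    "('a, 'n::finite) chart \<Rightarrow> ('a \<Rightarrow> real^'m::finite) \<Rightarrow> ('a \<Rightarrow> real^'n) \<Rightarrow> 'a \<Rightarrow> real" where
  "divergence c f w p =
     (\<Sum>i\<in>UNIV. \<Sum>j\<in>UNIV. metric_inv c f p $ i $ j * cov_deriv c f w j i p)"

definition raise :: "('a, 'n::finite) chart \<Rightarrow> ('a \<Rightarrow> real^'m::finite) \<Rightarrow> ('a \<Rightarrow> real^'n) \<Rightarrow> 'a \<Rightarrow> real^'n" where
  "raise c f w p = (\<chi> k. \<Sum>l\<in>UNIV. metric_inv c f p $ k $ l * w p $ l)"

definition gradient :: "('a, 'n::finite) chart \<Rightarrow> ('a \<Rightarrow> real^'m::finite) \<Rightarrow> ('a \<Rightarrow> real) \<Rightarrow> 'a \<Rightarrow> real^'n" where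
  "gradient c f u = raise c f (\<lambda>q. \<chi> l. partial c l u q)"

definition second_ff ::
    "('a, 'n::finite) chart \<Rightarrow> ('a \<Rightarrow> real^'m::finite) \<Rightarrow> ('a \<Rightarrow> real^'m) \<Rightarrow> 'a \<Rightarrow> real^'n^'n" where
  "second_ff c f \<nu> p = (\<chi> i j. - (partial c i f p \<bullet> partial c j \<nu> p))"

definition mean_curvature ::
    "('a, 'n::finite) chart \<Rightarrow> ('a \<Rightarrow> real^'m::finite) \<Rightarrow> ('a \<Rightarrow> real^'m) \<Rightarrow> 'a \<Rightarrow> real" where
  "mean_curvature c f \<nu> p =
     (\<Sum>i\<in>UNIV. \<Sum>j\<in>UNIV. metric_inv c f p $ i $ j * second_ff c f \<nu> p $ i $ j)"

text \<open>
  The volume form, read in a positively oriented chart \<open>c\<close>, is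
  \<open>sqrt (det g) dx\<^sup>1 \<and> \<dots> \<and> dx\<^sup>n\<close>. It is evaluated at \<open>n\<close> tangent vectors at \<open>p\<close>, whose
  components in \<open>c\<close> are the rows of \<open>V\<close>.
\<close>

definition volume_form :: "('a, 'n::finite) chart \<Rightarrow> ('a \<Rightarrow> real^'m::finite) \<Rightarrow> 'a \<Rightarrow> real^'n^'n \<Rightarrow> real" where
  "volume_form c f p V = sqrt (det (metric c f p)) * det V"


section \<open>Hyperbolic mean curvature flow\<close>

definition time_interval :: "ereal \<Rightarrow> real set" where
  "time_interval T = {t. 0 \<le> t \<and> ereal t < T}"

definition Ck_family ::
    "enat \<Rightarrow> ('a, 'n::finite) chart set \<Rightarrow> ereal \<Rightarrow> (real \<Rightarrow> 'a \<Rightarrow> real^'m::finite) \<Rightarrow> bool" where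
  "Ck_family k A T F \<longleftrightarrow>
     (\<forall>c\<in>A. Ck_on k (time_interval T \<times> coord c ` chart_dom c) (\<lambda>(t, x). F t (chart_inv c x)))"

definition immersion :: "('a, 'n::finite) chart set \<Rightarrow> ('a \<Rightarrow> real^'m::finite) \<Rightarrow> bool" where
  "immersion A f \<longleftrightarrow>
     (\<forall>c\<in>A. \<forall>p\<in>chart_dom c. inj (frechet_derivative (f \<circ> chart_inv c) (at (coord c p))))"

text \<open>
  A continuous unit normal field of a \<open>C\<^sup>2\<close> family of immersed hypersurfaces is
  automatically of class \<open>C\<^sup>1\<close>.
\<close>

definition unit_normal ::
    "('a, 'n::finite) chart set \<Rightarrow> ereal \<Rightarrow> (real \<Rightarrow> 'a \<Rightarrow> real^'m::finite) \<Rightarrow> (real \<Rightarrow> 'a \<Rightarrow> real^'m) \<Rightarrow> bool" where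
  "unit_normal A T F \<nu> \<longleftrightarrow>
     Ck_family 1 A T \<nu> \<and>
     (\<forall>t\<in>time_interval T. \<forall>c\<in>A. \<forall>p\<in>chart_dom c.
        norm (\<nu> t p) = 1 \<and> (\<forall>i. \<nu> t p \<bullet> partial c i (F t) p = 0))"

definition velocity :: "ereal \<Rightarrow> (real \<Rightarrow> 'a \<Rightarrow> real^'m::finite) \<Rightarrow> real \<Rightarrow> 'a \<Rightarrow> real^'m" where
  "velocity T F t p = vector_derivative (\<lambda>s. F s p) (at t within time_interval T)"

definition acceleration :: "ereal \<Rightarrow> (real \<Rightarrow> 'a \<Rightarrow> real^'m::finite) \<Rightarrow> real \<Rightarrow> 'a \<Rightarrow> real^'m" where
  "acceleration T F t p = vector_derivative (\<lambda>s. velocity T F s p) (at t within time_interval T)"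

definition sigma ::
    "ereal \<Rightarrow> (real \<Rightarrow> 'a \<Rightarrow> real^'m::finite) \<Rightarrow> (real \<Rightarrow> 'a \<Rightarrow> real^'m) \<Rightarrow> real \<Rightarrow> 'a \<Rightarrow> real" where
  "sigma T F \<nu> t p = velocity T F t p \<bullet> \<nu> t p"

definition tang_velocity ::
    "('a, 'n::finite) chart \<Rightarrow> ereal \<Rightarrow> (real \<Rightarrow> 'a \<Rightarrow> real^'m::finite) \<Rightarrow> real \<Rightarrow> 'a \<Rightarrow> real^'n" where
  "tang_velocity c T F t p = (\<chi> i. velocity T F t p \<bullet> partial c i (F t) p)"

definition energy_density ::
    "nat \<Rightarrow> ereal \<Rightarrow> (real \<Rightarrow> 'a \<Rightarrow> real^'m::finite) \<Rightarrow> real \<Rightarrow> 'a \<Rightarrow> real" where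
  "energy_density n T F t p = 1/2 * ((norm (velocity T F t p))\<^sup>2 + real n)"

definition HMCF ::
    "('a, 'n::finite) chart set \<Rightarrow> ereal \<Rightarrow> (real \<Rightarrow> 'a \<Rightarrow> real^'m::finite) \<Rightarrow> (real \<Rightarrow> 'a \<Rightarrow> real^'m) \<Rightarrow> bool" where
  "HMCF A T F \<nu> \<longleftrightarrow>
     (\<forall>t\<in>time_interval T. \<forall>c\<in>A. \<forall>p\<in>chart_dom c.
        let e = energy_density CARD('n) T F t;
            S = tang_velocity c T F t;
            S_up = raise c (F t) S p;
            norm_S_sq = S p \<bullet> S_up;
            \<sigma> = sigma T F \<nu> t p;
            H = mean_curvature c (F t) (\<nu> t) p;
            div_S = divergence c (F t) S p
        in acceleration T F t p =
             ((e p - norm_S_sq) * H - \<sigma> * div_S) *\<^sub>R \<nu> t p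
             + (\<Sum>k\<in>UNIV. ((\<sigma> * H - div_S) * S_up $ k - gradient c (F t) e p $ k)
                  *\<^sub>R partial c k (F t) p))"

end

theory Submission
  imports Defs
begin

text \<open>
  Differentiating the volume form gives \<open>d/dt d\<mu> = tr d\<mu>\<close> with
  \<open>tr = g\<^sup>i\<^sup>j \<langle>\<partial>\<^sub>i dF/dt, F\<^sub>j\<rangle>\<close>. For a vector field \<open>X\<close> along the hypersurface, the Gauss formula
  yields \<open>\<nabla>\<^sup>k\<langle>X, F\<^sub>k\<rangle> = g\<^sup>i\<^sup>j \<langle>\<partial>\<^sub>i X, F\<^sub>j\<rangle> + \<langle>X, \<nu>\<rangle> H\<close>. With \<open>X = dF/dt\<close> this
  reads \<open>d\<^sup>\<dagger>S = tr + \<sigma> H\<close>, since space and time derivatives commute; with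
  \<open>X = (n - e) F\<close> it evaluates the flux. After inserting the equation into \<open>\<langle>d\<^sup>2F/dt\<^sup>2, F\<rangle>\<close> and
  decomposing \<open>dF/dt\<close> into its normal and tangential parts, so that
  \<open>2 e - n = \<sigma>\<^sup>2 + |S|\<^sup>2\<close>, both sides agree as polynomials.
\<close>

section \<open>Linear algebra\<close>

lemma matrix_inv_cancel:
  fixes A :: "'a::field^'n^'n"
  assumes "invertible A"
  shows "A ** matrix_inv A = mat 1" "matrix_inv A ** A = mat 1"
proof -
  have "A ** matrix_inv A = mat 1 \<and> matrix_inv A ** A = mat 1"
    unfolding matrix_inv_def by (rule someI_ex) (use assms in \<open>simp add: invertible_def\<close>)
  then show "A ** matrix_inv A = mat 1" "matrix_inv A ** A = mat 1" by auto
qed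

lemma transpose_matrix_inv:
  fixes A :: "'a::field^'n^'n"
  assumes "invertible A" and "transpose A = A"
  shows "transpose (matrix_inv A) = matrix_inv A"
proof -
  have "transpose (matrix_inv A) ** A = mat 1"
    using arg_cong[OF matrix_inv_cancel(1)[OF assms(1)], of transpose]
    by (simp add: matrix_transpose_mul assms(2) transpose_mat)
  then have "transpose (matrix_inv A) ** (A ** matrix_inv A) = matrix_inv A"
    by (simp add: matrix_mul_assoc)
  then show ?thesis by (simp add: matrix_inv_cancel(1)[OF assms(1)])
qed

text \<open>Cramer's rule for rows: \<open>b\<close> is the combination of the rows of
  \<open>A\<close> with coefficients \<open>x = b v* matrix_inv A\<close>, and the determinant,
  being alternating, keeps only the coefficient of row \<open>k\<close>.\<close>

lemma det_replace_row:
  fixes A :: "'a::field^'n^'n"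
  assumes "invertible A"
  shows "det (\<chi> i. if i = k then b else row i A) = (\<Sum>j\<in>UNIV. b $ j * matrix_inv A $ j $ k) * det A"
proof -
  define x where "x = b v* matrix_inv A"
  have "b = x v* A"
    by (simp add: x_def vector_matrix_mul_assoc matrix_inv_cancel(2)[OF assms])
  then have "b = (\<Sum>i\<in>UNIV. x $ i *s row i A)"
    by (simp add: vec_eq_iff vector_matrix_mult_def row_def mult.commute)
  then have "det (\<chi> i. if i = k then b else row i A) = x $ k * det A"
    using cramer_lemma_transpose[of k x A] by metis
  then show ?thesis by (simp add: x_def vector_matrix_mult_def mult.commute)
qed

section \<open>Jacobi's formula and the derivative of the volume density\<close>

lemma has_field_derivative_prod_within:
  fixes f :: "'i \<Rightarrow> 'a::real_normed_field \<Rightarrow> 'a"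
  assumes "\<And>i. i \<in> I \<Longrightarrow> (f i has_field_derivative f' i) (at x within S)"
  shows "((\<lambda>x. \<Prod>i\<in>I. f i x) has_field_derivative (\<Sum>i\<in>I. f' i * (\<Prod>j\<in>I - {i}. f j x))) (at x within S)"
proof -
  have "((\<lambda>x. \<Prod>i\<in>I. f i x) has_derivative (\<lambda>y. \<Sum>i\<in>I. f' i * y * (\<Prod>j\<in>I - {i}. f j x))) (at x within S)"
    by (rule has_derivative_prod) (use assms in \<open>simp add: has_field_derivative_def\<close>)
  moreover have "(\<lambda>y. \<Sum>i\<in>I. f' i * y * (\<Prod>j\<in>I - {i}. f j x))
      = (*) (\<Sum>i\<in>I. f' i * (\<Prod>j\<in>I - {i}. f j x))"
    by (simp add: fun_eq_iff sum_distrib_left mult_ac)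
  ultimately show ?thesis by (simp add: has_field_derivative_def)
qed

text \<open>Jacobi's formula. The product rule in the Leibniz expansion differentiates one row at a
  time, and \<open>det_replace_row\<close> evaluates each determinant with one differentiated
  row.\<close>

lemma det_has_derivative:
  fixes G :: "real \<Rightarrow> real^'n^'n"
  assumes G: "\<And>i j. ((\<lambda>s. G s $ i $ j) has_real_derivative G' $ i $ j) (at t within I)"
    and inv: "invertible (G t)"
  shows "((\<lambda>s. det (G s)) has_real_derivative
      det (G t) * (\<Sum>i\<in>UNIV. \<Sum>j\<in>UNIV. G' $ i $ j * matrix_inv (G t) $ j $ i)) (at t within I)"
proof -
  let ?P = "{p. p permutes (UNIV :: 'n set)}"
  \<comment> \<open>Replacing the factor of row \<open>i\<close> in every Leibniz term gives the
    Leibniz expansion of the matrix whose row \<open>i\<close> is replaced.\<close>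
  have row: "(\<Sum>p\<in>?P. of_int (sign p) * (G' $ i $ p i * (\<Prod>j\<in>UNIV - {i}. G t $ j $ p j)))
      = det (\<chi> k. if k = i then G' $ i else row k (G t))" for i
    unfolding det_def
  proof (rule sum.cong[OF refl])
    fix p :: "'n \<Rightarrow> 'n"
    have "(\<Prod>k\<in>UNIV. (\<chi> k. if k = i then G' $ i else row k (G t)) $ k $ p k)
      = G' $ i $ p i * (\<Prod>j\<in>UNIV - {i}. G t $ j $ p j)"
      by (subst prod.remove[of _ i]) (auto intro!: prod.cong simp: row_def)
    then show "of_int (sign p) * (G' $ i $ p i * (\<Prod>j\<in>UNIV - {i}. G t $ j $ p j)) =
      of_int (sign p) * (\<Prod>k\<in>UNIV. (\<chi> k. if k = i then G' $ i else row k (G t)) $ k $ p k)" by simp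
  qed
  have "((\<lambda>s. det (G s)) has_real_derivative
      (\<Sum>p\<in>?P. of_int (sign p) * (\<Sum>i\<in>UNIV. G' $ i $ p i * (\<Prod>j\<in>UNIV - {i}. G t $ j $ p j)))) (at t within I)"
    unfolding det_def
    by (intro DERIV_sum DERIV_cmult has_field_derivative_prod_within G)
  also have "(\<Sum>p\<in>?P. of_int (sign p) * (\<Sum>i\<in>UNIV. G' $ i $ p i * (\<Prod>j\<in>UNIV - {i}. G t $ j $ p j)))
     = (\<Sum>i\<in>UNIV. det (\<chi> k. if k = i then G' $ i else row k (G t)))"
    unfolding row[symmetric] by (subst sum.swap) (simp add: sum_distrib_left)
  finally show ?thesis
    by (simp add: det_replace_row[OF inv] sum_distrib_left sum_distrib_right mult.commute)
qed

text \<open>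
  \<open>sqrt\<close> is an odd function on all reals, so its derivative at \<open>x \<noteq> 0\<close> is \<open>sqrt x / (2 * x)\<close> for
  either sign.
\<close>

lemma sqrt_det_has_derivative:
  fixes G :: "real \<Rightarrow> real^'n^'n"
  assumes G: "\<And>i j. ((\<lambda>s. G s $ i $ j) has_real_derivative G' $ i $ j) (at t within I)"
    and inv: "invertible (G t)"
  shows "((\<lambda>s. sqrt (det (G s))) has_real_derivative
      sqrt (det (G t)) * (\<Sum>i\<in>UNIV. \<Sum>j\<in>UNIV. G' $ i $ j * matrix_inv (G t) $ j $ i) / 2) (at t within I)"
proof -
  let ?d = "det (G t)"
  have nz: "?d \<noteq> 0" using inv by (simp add: invertible_det_nz)
  have "(sqrt has_real_derivative sqrt ?d / (2 * ?d)) (at ?d)"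
  proof (rule DERIV_real_sqrt_generic[OF nz])
    assume "?d > 0"
    then show "sqrt ?d / (2 * ?d) = inverse (sqrt ?d) / 2"
      by (simp add: field_simps)
  next
    assume "?d < 0"
    \<comment> \<open>For negative arguments \<open>sqrt x\<close> is \<open>- sqrt (- x)\<close>,
      so its square is the absolute value.\<close>
    then have "sqrt ?d * sqrt ?d = - ?d" "sqrt ?d \<noteq> 0"
      by (auto simp: real_sqrt_mult_self)
    then show "sqrt ?d / (2 * ?d) = - inverse (sqrt ?d) / 2"
      using nz by (simp add: field_simps)
  qed
  from DERIV_chain2[OF this det_has_derivative[OF G inv]]
  show ?thesis using nz by (simp add: field_simps)
qed

section \<open>Gram matrices and frames completed by a unit normal\<close>

definition independent_family :: "('n::finite \<Rightarrow> 'b::real_vector) \<Rightarrow> bool" where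
  "independent_family E \<longleftrightarrow> (\<forall>\<xi> :: real^'n. (\<Sum>i\<in>UNIV. \<xi> $ i *\<^sub>R E i) = 0 \<longrightarrow> \<xi> = 0)"

definition gram :: "('n::finite \<Rightarrow> 'b::real_inner) \<Rightarrow> real^'n^'n" where
  "gram E = (\<chi> i j. E i \<bullet> E j)"

text \<open>The quadratic form of the Gram matrix at \<open>\<xi>\<close> is the squared length of
  the combination of the \<open>E i\<close> with coefficients \<open>\<xi>\<close>, so independence
  makes the kernel trivial.\<close>

lemma gram_invertible:
  fixes E :: "'n::finite \<Rightarrow> 'b::real_inner"
  assumes "independent_family E"
  shows "invertible (gram E)"
  unfolding invertible_left_inverse matrix_left_invertible_ker
proof (intro allI impI)
  fix \<xi> :: "real^'n" assume "gram E *v \<xi> = 0"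
  then have "\<xi> \<bullet> (gram E *v \<xi>) = 0" by simp
  then have "(\<Sum>i\<in>UNIV. \<xi> $ i *\<^sub>R E i) \<bullet> (\<Sum>i\<in>UNIV. \<xi> $ i *\<^sub>R E i) = 0"
    by (simp add: gram_def inner_vec_def matrix_vector_mult_def inner_sum_left inner_sum_right
        sum_distrib_left inner_commute mult_ac)
  then show "\<xi> = 0" using assms by (simp add: independent_family_def)
qed

lemma gram_inv:
  fixes E :: "'n::finite \<Rightarrow> 'b::real_inner"
  assumes "independent_family E"
  defines "R \<equiv> matrix_inv (gram E)"
  shows "R $ i $ j = R $ j $ i"
    and "(\<Sum>k\<in>UNIV. R $ i $ k * (E k \<bullet> E j)) = (if i = j then 1 else 0)"
proof -
  note inv = gram_invertible[OF assms(1)]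
  have "transpose (gram E) = gram E"
    unfolding Finite_Cartesian_Product.transpose_def gram_def vec_eq_iff
    by (auto intro: inner_commute)
  then have "transpose R = R"
    unfolding R_def by (rule transpose_matrix_inv[OF inv])
  then show "R $ i $ j = R $ j $ i"
    unfolding Finite_Cartesian_Product.transpose_def vec_eq_iff by simp
  have "(R ** gram E) $ i $ j = (mat 1 :: real^'n^'n) $ i $ j"
    unfolding R_def by (simp add: matrix_inv_cancel(2)[OF inv])
  then show "(\<Sum>k\<in>UNIV. R $ i $ k * (E k \<bullet> E j)) = (if i = j then 1 else 0)"
    by (simp add: matrix_matrix_mult_def gram_def mat_def)
qed

text \<open>By the dimension count, \<open>N\<close> and the \<open>E k\<close> span the whole
  space. The difference of the two sides is orthogonal to all of them, hence to itself.\<close>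

lemma frame_decomposition:
  fixes E :: "'n::finite \<Rightarrow> real^'m::finite"
  assumes ind: "independent_family E"
    and card: "CARD('m) = CARD('n) + 1"
    and unit: "norm N = 1" and orth: "\<And>i. N \<bullet> E i = 0"
  shows "x = (x \<bullet> N) *\<^sub>R N
    + (\<Sum>k\<in>UNIV. (\<Sum>l\<in>UNIV. matrix_inv (gram E) $ k $ l * (x \<bullet> E l)) *\<^sub>R E k)"
proof -
  define L where "L \<xi> = (\<Sum>i\<in>UNIV. \<xi> $ i *\<^sub>R E i)" for \<xi> :: "real^'n"
  have lin: "linear L"
    by (rule linearI) (simp_all add: L_def scaleR_add_left sum.distrib scaleR_sum_right)
  have "inj L" unfolding linear_injective_0[OF lin] using ind by (simp add: L_def independent_family_def)
  then have "dim (range L) = CARD('n)"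
    using dim_image_eq[OF lin, of UNIV] by simp
  moreover have sub: "subspace (range L)"
    by (simp add: lin linear_subspace_image)
  have NL: "orthogonal N y" if "y \<in> range L" for y
    using that orth by (auto simp: L_def orthogonal_def inner_sum_right)
  have "N \<notin> range L"
    using NL[of N] unit by (auto simp: orthogonal_def)
  then have "N \<notin> span (range L)"
    using sub by (metis span_eq_iff)
  ultimately have "dim (insert N (range L)) = DIM(real^'m)"
    by (simp add: dim_insert card)
  then have full: "span (insert N (range L)) = UNIV"
    by (rule dim_eq_full[THEN iffD1])
  define y where "y = x - (x \<bullet> N) *\<^sub>R N
    - (\<Sum>k\<in>UNIV. (\<Sum>l\<in>UNIV. matrix_inv (gram E) $ k $ l * (x \<bullet> E l)) *\<^sub>R E k)"
  have NN: "N \<bullet> N = 1" using unit by (simp add: norm_eq_1)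
  have yE: "y \<bullet> E j = 0" for j
  proof -
    \<comment> \<open>Symmetry of the inverse lets it be contracted with the Gram matrix over
      \<open>k\<close>, which leaves a Kronecker delta.\<close>
    have "(\<Sum>k\<in>UNIV. (\<Sum>l\<in>UNIV. matrix_inv (gram E) $ k $ l * (x \<bullet> E l)) * (E k \<bullet> E j))
      = (\<Sum>l\<in>UNIV. (x \<bullet> E l) * (\<Sum>k\<in>UNIV. matrix_inv (gram E) $ l $ k * (E k \<bullet> E j)))"
      unfolding sum_distrib_left sum_distrib_right
      by (subst sum.swap, intro sum.cong refl)
        (subst gram_inv(1)[OF ind], simp_all add: mult_ac)
    also have "\<dots> = (\<Sum>l\<in>UNIV. if l = j then x \<bullet> E l else 0)"
      unfolding gram_inv(2)[OF ind] by (intro sum.cong) auto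
    also have "\<dots> = x \<bullet> E j" by simp
    finally show ?thesis by (simp add: y_def inner_diff_left inner_sum_left orth)
  qed
  have "E k \<bullet> N = 0" for k using orth[of k] by (simp add: inner_commute)
  then have "y \<bullet> N = 0" by (simp add: y_def inner_diff_left inner_sum_left NN)
  then have "orthogonal y z" if "z \<in> insert N (range L)" for z
    using that yE by (auto simp: L_def orthogonal_def inner_sum_right)
  then have "orthogonal y y"
    using orthogonal_to_span[of y "insert N (range L)"] full by blast
  then have "y = 0" by (simp add: orthogonal_def)
  then show ?thesis by (simp add: y_def diff_diff_eq)
qed

section \<open>Symmetry of second derivatives\<close>

text \<open>
  One-sided, because the initial time is a boundary point. The idea is to differentiate
  \<open>G s \<rho> - G s 0 = \<integral>\<^sub>0\<^sup>\<rho> Gr s\<close> with respect to \<open>s\<close> under the integral.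
\<close>

lemma second_derivative_symmetric_corner:
  fixes G :: "real \<Rightarrow> real \<Rightarrow> 'b::banach"
  assumes d: "0 < d"
    and r: "\<And>s r. s \<in> {0..d} \<Longrightarrow> r \<in> {0..d} \<Longrightarrow> (G s has_vector_derivative Gr s r) (at r within {0..d})"
    and s: "\<And>r. r \<in> {0..d} \<Longrightarrow> ((\<lambda>s. G s r) has_vector_derivative Gs r) (at 0 within {0..d})"
    and rs: "\<And>s r. s \<in> {0..d} \<Longrightarrow> r \<in> {0..d} \<Longrightarrow>
        ((\<lambda>s. Gr s r) has_vector_derivative Grs s r) (at s within {0..d})"
    and cont: "continuous_on ({0..d} \<times> {0..d}) (\<lambda>(s, r). Grs s r)"
    and sr: "(Gs has_vector_derivative D) (at 0 within {0..d})"
  shows "D = Grs 0 0"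
proof -
  have unique: "a = b" if "(f has_vector_derivative a) (at 0 within {0..d})"
    "(f has_vector_derivative b) (at 0 within {0..d})" for f :: "real \<Rightarrow> 'b" and a b
    using vector_derivative_unique_within_closed_interval[of 0 d 0 f a b] that d
    by (auto simp: cbox_interval)
  have Gs: "Gs \<rho> = Gs 0 + integral {0..\<rho>} (Grs 0)" if \<rho>: "\<rho> \<in> {0..d}" for \<rho>
  proof -
    have int: "(Gr s has_integral G s \<rho> - G s 0) {0..\<rho>}" if "s \<in> {0..d}" for s
      by (rule fundamental_theorem_of_calculus)
        (use \<rho> that in \<open>auto intro: has_vector_derivative_within_subset[OF r]\<close>)
    have "((\<lambda>s. integral (cbox 0 \<rho>) (Gr s)) has_vector_derivative integral (cbox 0 \<rho>) (Grs 0))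
        (at 0 within {0..d})"
    proof (rule leibniz_rule_vector_derivative)
      show "continuous_on ({0..d} \<times> cbox 0 \<rho>) (\<lambda>(s, r). Grs s r)"
        by (rule continuous_on_subset[OF cont]) (use \<rho> in auto)
    qed (use \<rho> d rs int in \<open>auto intro: has_integral_integrable\<close>)
    then have 1: "((\<lambda>s. integral {0..\<rho>} (Gr s)) has_vector_derivative integral {0..\<rho>} (Grs 0))
        (at 0 within {0..d})" by (simp add: cbox_interval)
    have 2: "((\<lambda>s. G s \<rho> - G s 0) has_vector_derivative integral {0..\<rho>} (Grs 0)) (at 0 within {0..d})"
      by (rule has_vector_derivative_transform[OF _ _ 1]) (use d int in \<open>auto intro!: integral_unique[symmetric]\<close>)
    \<comment> \<open>Termwise differentiation of the expression just differentiated under the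
      integral; uniqueness equates the two results.\<close>
    have "((\<lambda>s. G s \<rho> - G s 0) has_vector_derivative Gs \<rho> - Gs 0) (at 0 within {0..d})"
      by (intro has_vector_derivative_diff s) (use \<rho> d in auto)
    from unique[OF 2 this] show ?thesis by simp
  qed
  \<comment> \<open>By the formula for \<open>Gs \<rho>\<close>, the fundamental theorem of calculus
    at the endpoint 0 now shows that \<open>Gs\<close> has derivative \<open>Grs 0 0\<close>
    there.\<close>
  have "continuous_on {0..d} (Pair (0::real))" by (intro continuous_intros)
  then have "continuous_on {0..d} (Grs 0)"
    using continuous_on_compose2[OF cont, of "{0..d}" "Pair 0"] d by (auto simp: image_subset_iff)
  from integral_has_vector_derivative[OF this, of 0]
  have "((\<lambda>\<rho>. Gs 0 + integral {0..\<rho>} (Grs 0)) has_vector_derivative 0 + Grs 0 0) (at 0 within {0..d})"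
    using d by (intro has_vector_derivative_add has_vector_derivative_const) auto
  then have deriv: "((\<lambda>\<rho>. Gs 0 + integral {0..\<rho>} (Grs 0)) has_vector_derivative Grs 0 0) (at 0 within {0..d})"
    by simp
  have "(Gs has_vector_derivative Grs 0 0) (at 0 within {0..d})"
    by (rule has_vector_derivative_transform[OF _ Gs deriv]) (use d in auto)
  from unique[OF sr this] show ?thesis .
qed

text \<open>The chain rule along a line, the common source of all time derivatives and partial
  derivatives below. The set \<open>J\<close> admits one-sided derivatives as well as open
  coordinate lines.\<close>

lemma directional_derivative:
  assumes "\<forall>x\<in>D. (f has_derivative f' x) (at x within D)"
    and J: "\<forall>s\<in>J. x + s *\<^sub>R u \<in> D" and s: "s \<in> J"
  shows "((\<lambda>s. f (x + s *\<^sub>R u)) has_vector_derivative f' (x + s *\<^sub>R u) u) (at s within J)"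
proof -
  have D: "(f has_derivative f' (x + s *\<^sub>R u)) (at (x + s *\<^sub>R u) within D)"
    using assms by blast
  have "((\<lambda>s. x + s *\<^sub>R u) has_derivative (\<lambda>h. h *\<^sub>R u)) (at s within J)"
    by (auto intro!: derivative_eq_intros)
  from has_derivative_in_compose[OF this has_derivative_subset[OF D]] J
  have "((\<lambda>s. f (x + s *\<^sub>R u)) has_derivative (\<lambda>h. f' (x + s *\<^sub>R u) (h *\<^sub>R u))) (at s within J)"
    by blast
  moreover have "f' (x + s *\<^sub>R u) (h *\<^sub>R u) = h *\<^sub>R f' (x + s *\<^sub>R u) u" for h
    using linear_scale[OF has_derivative_linear[OF D]] .
  ultimately show ?thesis by (simp add: has_vector_derivative_def)
qed

text \<open>The corner lemma applied on the parallelogram at \<open>x\<close> spanned by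
  \<open>u\<close> and \<open>w\<close>. Only nonnegative parameters occur, so \<open>x\<close> may
  lie on the boundary of \<open>D\<close>.\<close>

lemma second_derivative_symmetric_within:
  fixes f :: "'a::real_normed_vector \<Rightarrow> 'b::banach"
  assumes f': "\<forall>x\<in>D. (f has_derivative f' x) (at x within D)"
    and f'': "\<And>v. \<forall>x\<in>D. ((\<lambda>x. f' x v) has_derivative f'' v x) (at x within D)"
    and cont: "\<And>v w. continuous_on D (\<lambda>x. f'' v x w)"
    and d: "0 < d"
    and D: "\<And>s r. s \<in> {0..d} \<Longrightarrow> r \<in> {0..d} \<Longrightarrow> x + s *\<^sub>R u + r *\<^sub>R w \<in> D"
  shows "f'' u x w = f'' w x u"
proof -
  \<comment> \<open>\<open>directional_derivative\<close> wants the moving summand last, which is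
    \<open>r *\<^sub>R w\<close> for one variable and \<open>s *\<^sub>R u\<close> for the
    other.\<close>
  have swap: "x + s *\<^sub>R u + r *\<^sub>R w = x + r *\<^sub>R w + s *\<^sub>R u" for s r
    by (simp only: add.assoc add.commute[of "s *\<^sub>R u"])
  have D0: "\<forall>r\<in>{0..d}. x + r *\<^sub>R w \<in> D" using D[of 0] d by simp
  have Dr: "\<forall>r\<in>{0..d}. x + s *\<^sub>R u + r *\<^sub>R w \<in> D" if "s \<in> {0..d}" for s
    using D that by blast
  have Ds: "\<forall>s\<in>{0..d}. x + r *\<^sub>R w + s *\<^sub>R u \<in> D" if "r \<in> {0..d}" for r
    using D[OF _ that] unfolding swap by blast
  have 1: "((\<lambda>r. f (x + s *\<^sub>R u + r *\<^sub>R w)) has_vector_derivative f' (x + s *\<^sub>R u + r *\<^sub>R w) w)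
      (at r within {0..d})" if "s \<in> {0..d}" "r \<in> {0..d}" for s r
    by (rule directional_derivative[OF f' Dr[OF that(1)] that(2)])
  have 2: "((\<lambda>s. f (x + s *\<^sub>R u + r *\<^sub>R w)) has_vector_derivative f' (x + r *\<^sub>R w) u)
      (at 0 within {0..d})" if "r \<in> {0..d}" for r
    using directional_derivative[OF f' Ds[OF that], of 0] d unfolding swap by simp
  have 3: "((\<lambda>s. f' (x + s *\<^sub>R u + r *\<^sub>R w) w) has_vector_derivative f'' w (x + r *\<^sub>R w + s *\<^sub>R u) u)
      (at s within {0..d})" if "s \<in> {0..d}" "r \<in> {0..d}" for s r
    unfolding swap by (rule directional_derivative[OF f'' Ds[OF that(2)] that(1)])
  have "continuous_on ({0..d} \<times> {0..d}) (\<lambda>z. x + snd z *\<^sub>R w + fst z *\<^sub>R u)"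
    by (intro continuous_intros)
  moreover have "(\<lambda>z. x + snd z *\<^sub>R w + fst z *\<^sub>R u) ` ({0..d} \<times> {0..d}) \<subseteq> D"
    using Ds by fastforce
  ultimately have 4: "continuous_on ({0..d} \<times> {0..d}) (\<lambda>(s, r). f'' w (x + r *\<^sub>R w + s *\<^sub>R u) u)"
    unfolding case_prod_beta by (rule continuous_on_compose2[OF cont[of w u]])
  have 5: "((\<lambda>r. f' (x + r *\<^sub>R w) u) has_vector_derivative f'' u x w) (at 0 within {0..d})"
    using directional_derivative[OF f'' D0, of 0 u] d by simp
  show ?thesis
    using second_derivative_symmetric_corner[where
        G = "\<lambda>s r. f (x + s *\<^sub>R u + r *\<^sub>R w)" and Gr = "\<lambda>s r. f' (x + s *\<^sub>R u + r *\<^sub>R w) w" and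
        Gs = "\<lambda>r. f' (x + r *\<^sub>R w) u" and Grs = "\<lambda>s r. f'' w (x + r *\<^sub>R w + s *\<^sub>R u) u", OF d 1 2 3 4 5]
    by simp
qed

section \<open>Hypersurfaces in a chart\<close>

text \<open>\<open>partial\<close> has some value even where no derivative exists; this relation
  also records differentiability, as the product rules require.\<close>

definition has_partial ::
    "('a, 'n::finite) chart \<Rightarrow> 'n \<Rightarrow> ('a \<Rightarrow> 'b::real_normed_vector) \<Rightarrow> 'b \<Rightarrow> 'a \<Rightarrow> bool" where
  "has_partial c i f D p \<longleftrightarrow>
     ((\<lambda>s. f (chart_inv c (coord c p + s *\<^sub>R axis i 1))) has_vector_derivative D) (at 0)"

lemma has_partial_imp_partial: "has_partial c i f D p \<Longrightarrow> partial c i f p = D"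
  by (simp add: has_partial_def partial_def vector_derivative_at)

locale chart_point =
  fixes c :: "('a, 'n::finite) chart" and p :: 'a
  assumes inj: "inj_on (coord c) (chart_dom c)"
    and open_image: "open (coord c ` chart_dom c)"
    and p_in: "p \<in> chart_dom c"
begin

lemma chart_inv_coord [simp]: "q \<in> chart_dom c \<Longrightarrow> chart_inv c (coord c q) = q"
  by (simp add: chart_inv_def inj)

lemma coord_chart_inv [simp]: "y \<in> coord c ` chart_dom c \<Longrightarrow> coord c (chart_inv c y) = y"
  by (auto simp: chart_inv_def inj)

lemma chart_inv_in [simp]: "y \<in> coord c ` chart_dom c \<Longrightarrow> chart_inv c y \<in> chart_dom c"
  by (auto simp: chart_inv_def inj)

text \<open>Off the image of the chart \<open>chart_inv\<close> is unspecified, so coordinate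
  representations are compared on this set only; as an open neighbourhood of 0 it determines the
  derivative there.\<close>

definition coord_line :: "'n \<Rightarrow> real set" where
  "coord_line i = {s. coord c p + s *\<^sub>R axis i 1 \<in> coord c ` chart_dom c}"

lemma open_coord_line: "open (coord_line i)"
proof -
  have "open ((\<lambda>s. coord c p + s *\<^sub>R axis i 1) -` (coord c ` chart_dom c))"
    by (rule open_vimage[OF open_image]) (intro continuous_intros)
  then show ?thesis by (simp add: coord_line_def vimage_def)
qed

lemma zero_in_coord_line: "0 \<in> coord_line i"
  using p_in by (simp add: coord_line_def)

lemma has_partialI:
  assumes "\<And>q. q \<in> chart_dom c \<Longrightarrow> f q = Y (coord c q)"
    and "((\<lambda>s. Y (coord c p + s *\<^sub>R axis i 1)) has_vector_derivative D) (at 0 within coord_line i)"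
  shows "has_partial c i f D p"
proof -
  have "((\<lambda>s. f (chart_inv c (coord c p + s *\<^sub>R axis i 1))) has_vector_derivative D) (at 0 within coord_line i)"
    by (rule has_vector_derivative_transform[OF zero_in_coord_line _ assms(2)])
      (simp add: coord_line_def assms(1))
  then show ?thesis
    by (simp add: has_partial_def at_within_open[OF zero_in_coord_line open_coord_line])
qed

lemma has_partial_cong:
  assumes "\<And>q. q \<in> chart_dom c \<Longrightarrow> f q = g q" and "has_partial c i g D p"
  shows "has_partial c i f D p"
proof (rule has_partialI)
  show "f q = (g \<circ> chart_inv c) (coord c q)" if "q \<in> chart_dom c" for q
    using that assms(1) by simp
  show "((\<lambda>s. (g \<circ> chart_inv c) (coord c p + s *\<^sub>R axis i 1)) has_vector_derivative D) (at 0 within coord_line i)"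
    using assms(2) by (simp add: has_partial_def has_vector_derivative_at_within)
qed

lemma has_partial_bilinear:
  assumes "bounded_bilinear mul" "has_partial c i f a p" "has_partial c i g b p"
  shows "has_partial c i (\<lambda>q. mul (f q) (g q)) (mul (f p) b + mul a (g p)) p"
  using bounded_bilinear.has_vector_derivative[OF assms(1) assms(2,3)[unfolded has_partial_def]] p_in
  by (simp add: has_partial_def)

lemmas has_partial_inner = has_partial_bilinear[OF bounded_bilinear_inner]
  and has_partial_scaleR = has_partial_bilinear[OF bounded_bilinear_scaleR]

end

text \<open>\<open>B i j\<close> is the second partial derivative of \<open>f\<close>, first in
  direction \<open>j\<close>, then in direction \<open>i\<close>. Orthogonality is assumed on the
  whole chart because it gets differentiated; the unit length is used at \<open>p\<close>.\<close>

locale hypersurface_point = chart_point c p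
  for c :: "('a, 'n::finite) chart" and p :: 'a +
  fixes f \<nu> :: "'a \<Rightarrow> real^'m::finite" and B :: "'n \<Rightarrow> 'n \<Rightarrow> real^'m"
  assumes card: "CARD('m) = CARD('n) + 1"
    and second_partial: "\<And>i j. has_partial c i (partial c j f) (B i j) p"
    and B_sym: "\<And>i j. B i j = B j i"
    and independent: "independent_family (\<lambda>i. partial c i f p)"
    and normal_partial: "\<And>i. has_partial c i \<nu> (partial c i \<nu> p) p"
    and normal_unit: "norm (\<nu> p) = 1"
    and normal_orth: "\<And>q i. q \<in> chart_dom c \<Longrightarrow> \<nu> q \<bullet> partial c i f q = 0"
begin

abbreviation "E i \<equiv> partial c i f p"
abbreviation "R \<equiv> metric_inv c f p"

lemma metric_inv_gram: "metric_inv c f p = matrix_inv (gram E)"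
  by (simp add: metric_inv_def metric_def gram_def)

lemma metric_invertible: "invertible (metric c f p)"
  using gram_invertible[OF independent] by (simp add: metric_def gram_def)

lemma metric_inv_sym: "R $ i $ j = R $ j $ i"
  unfolding metric_inv_gram by (rule gram_inv(1)[OF independent])

lemma metric_inv_mult: "(\<Sum>k\<in>UNIV. R $ i $ k * (E k \<bullet> E j)) = (if i = j then 1 else 0)"
  unfolding metric_inv_gram by (rule gram_inv(2)[OF independent])

lemma decomposition:
  "x = (x \<bullet> \<nu> p) *\<^sub>R \<nu> p + (\<Sum>k\<in>UNIV. (\<Sum>l\<in>UNIV. R $ k $ l * (x \<bullet> E l)) *\<^sub>R E k)"
  unfolding metric_inv_gram
  by (rule frame_decomposition[OF independent card normal_unit normal_orth[OF p_in]])

lemma inner_decomposition: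
  "x \<bullet> y = (x \<bullet> \<nu> p) * (\<nu> p \<bullet> y) + (\<Sum>k\<in>UNIV. (\<Sum>l\<in>UNIV. R $ k $ l * (x \<bullet> E l)) * (E k \<bullet> y))"
  by (subst decomposition[of x]) (simp add: inner_add_left inner_sum_left)

text \<open>Each derivative of the metric is a sum of two products of \<open>B\<close> with
  \<open>E\<close>. By symmetry of \<open>B\<close> all cancel except two equal ones, so the
  Christoffel symbols are the tangential components of \<open>B i j\<close>.\<close>

lemma christoffel_eq: "christoffel c f k i j p = (\<Sum>l\<in>UNIV. R $ k $ l * (B i j \<bullet> E l))"
proof -
  have d: "partial c i (\<lambda>q. metric c f q $ j $ l) p = E j \<bullet> B i l + B i j \<bullet> E l" for i j l
    by (rule has_partial_imp_partial)
      (simp add: metric_def has_partial_inner[OF second_partial second_partial])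
  have "partial c i (\<lambda>q. metric c f q $ j $ l) p + partial c j (\<lambda>q. metric c f q $ i $ l) p
      - partial c l (\<lambda>q. metric c f q $ i $ j) p = 2 * (B i j \<bullet> E l)" for l
    unfolding d using B_sym[of i l] B_sym[of j l] B_sym[of i j] by (simp add: inner_commute)
  then show ?thesis by (simp add: christoffel_def sum_distrib_left)
qed

text \<open>Obtained by differentiating the orthogonality of \<open>\<nu>\<close> and
  \<open>partial c i f\<close> in direction \<open>j\<close>: the second fundamental form is the
  normal component of \<open>B\<close>.\<close>

lemma second_ff_eq: "second_ff c f \<nu> p $ i $ j = \<nu> p \<bullet> B j i"
proof -
  have "has_partial c j (\<lambda>q. \<nu> q \<bullet> partial c i f q) 0 p"
    by (rule has_partial_cong[where g = "\<lambda>_. 0"]) (simp_all add: normal_orth has_partial_def)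
  moreover have "has_partial c j (\<lambda>q. \<nu> q \<bullet> partial c i f q) (\<nu> p \<bullet> B j i + partial c j \<nu> p \<bullet> E i) p"
    by (rule has_partial_inner[OF normal_partial second_partial])
  ultimately have "\<nu> p \<bullet> B j i + partial c j \<nu> p \<bullet> E i = 0"
    by (metis has_partial_imp_partial)
  then show ?thesis by (simp add: second_ff_def inner_commute)
qed

text \<open>The product rule produces a term with \<open>B j i\<close>. Its tangential part is
  exactly the Christoffel correction; its normal part, traced, gives the mean curvature
  term.\<close>

lemma divergence_tangential:
  assumes X: "\<And>i. has_partial c i X (dX i) p"
  shows "divergence c f (\<lambda>q. \<chi> k. X q \<bullet> partial c k f q) p
    = (\<Sum>i\<in>UNIV. \<Sum>j\<in>UNIV. R $ i $ j * (dX j \<bullet> E i)) + (X p \<bullet> \<nu> p) * mean_curvature c f \<nu> p"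
proof -
  have "cov_deriv c f (\<lambda>q. \<chi> k. X q \<bullet> partial c k f q) j i p
      = dX j \<bullet> E i + (X p \<bullet> \<nu> p) * second_ff c f \<nu> p $ i $ j" for i j
  proof -
    have "partial c j (\<lambda>q. X q \<bullet> partial c i f q) p = X p \<bullet> B j i + dX j \<bullet> E i"
      by (rule has_partial_imp_partial[OF has_partial_inner[OF X second_partial]])
    then show ?thesis
      using inner_decomposition[of "B j i" "X p"]
      by (simp add: cov_deriv_def christoffel_eq second_ff_eq inner_commute)
  qed
  then show ?thesis
    by (simp add: divergence_def mean_curvature_def sum.distrib sum_distrib_left algebra_simps)
qed

end

section \<open>Families of class \<open>C\<^sup>2\<close>\<close>

text \<open>\<open>Ck_on_nat\<close> provides a derivative of \<open>f' x v\<close> for each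
  \<open>v\<close> separately; choice collects them into one \<open>f''\<close>, whose arguments are
  first direction, point, second direction.\<close>

lemma Ck_on_nat_2_obtain:
  assumes "Ck_on_nat 2 D f"
  obtains f' f'' where "\<forall>x\<in>D. (f has_derivative f' x) (at x within D)"
    "\<And>v. \<forall>x\<in>D. ((\<lambda>x. f' x v) has_derivative f'' v x) (at x within D)"
    "\<And>v w. continuous_on D (\<lambda>x. f'' v x w)"
proof -
  obtain f' where f': "\<forall>x\<in>D. (f has_derivative f' x) (at x within D)"
    and "\<forall>v. Ck_on_nat (Suc 0) D (\<lambda>x. f' x v)"
    using assms by (auto simp: numeral_2_eq_2)
  then have "\<forall>v. \<exists>g. (\<forall>x\<in>D. ((\<lambda>x. f' x v) has_derivative g x) (at x within D)) \<and>
      (\<forall>w. continuous_on D (\<lambda>x. g x w))" by simp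
  then obtain f'' where "\<forall>v. (\<forall>x\<in>D. ((\<lambda>x. f' x v) has_derivative f'' v x) (at x within D)) \<and>
      (\<forall>w. continuous_on D (\<lambda>x. f'' v x w))" by (rule choice[THEN exE])
  with f' show thesis by (intro that[of f' f'']) auto
qed

lemma time_interval_right:
  assumes "t \<in> time_interval T"
  obtains d where "0 < d" "{t..t + d} \<subseteq> time_interval T"
proof -
  from assms obtain b where b: "ereal t < ereal b" "ereal b < T"
    using ereal_dense2[of "ereal t" T] by (auto simp: time_interval_def)
  have "ereal s < T" if "s \<le> b" for s
    using b(2) that by (metis ereal_less_eq(3) le_less_trans)
  then have "{t..t + (b - t)} \<subseteq> time_interval T"
    using assms by (auto simp: time_interval_def)
  with b show thesis by (intro that[of "b - t"]) auto
qed

text \<open>This makes one-sided time derivatives unique, so that \<open>velocity\<close> and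
  \<open>acceleration\<close> can be computed, at the initial time too.\<close>

lemma at_within_time_interval_nonbot:
  assumes "t \<in> time_interval T"
  shows "at t within time_interval T \<noteq> bot"
proof -
  obtain d where d: "0 < d" "{t..t + d} \<subseteq> time_interval T"
    using time_interval_right[OF assms] .
  have "t islimpt {t<..<t + d}" using d by (simp add: islimpt_greaterThanLessThan1)
  then have "t islimpt time_interval T"
    by (rule islimpt_subset) (use d in auto)
  then show ?thesis by (simp add: trivial_limit_within)
qed

text \<open>Time and space derivatives are read off the same \<open>f'\<close> and
  \<open>f''\<close>: \<open>(1, 0)\<close> is the time direction and \<open>(0, axis i 1)\<close>
  the \<open>i\<close>-th coordinate direction.\<close>

locale C2_family_point = chart_point c p
  for c :: "('a, 'n::finite) chart" and p :: 'a +
  fixes T :: ereal and F :: "real \<Rightarrow> 'a \<Rightarrow> real^'m::finite"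
    and f' :: "real \<times> (real^'n) \<Rightarrow> real \<times> (real^'n) \<Rightarrow> real^'m"
    and f'' :: "real \<times> (real^'n) \<Rightarrow> real \<times> (real^'n) \<Rightarrow> real \<times> (real^'n) \<Rightarrow> real^'m"
  assumes f': "\<forall>x\<in>time_interval T \<times> coord c ` chart_dom c.
      ((\<lambda>(t, x). F t (chart_inv c x)) has_derivative f' x) (at x within time_interval T \<times> coord c ` chart_dom c)"
    and f'': "\<And>v. \<forall>x\<in>time_interval T \<times> coord c ` chart_dom c.
      ((\<lambda>x. f' x v) has_derivative f'' v x) (at x within time_interval T \<times> coord c ` chart_dom c)"
    and cont: "\<And>v w. continuous_on (time_interval T \<times> coord c ` chart_dom c) (\<lambda>x. f'' v x w)"
begin

abbreviation "I \<equiv> time_interval T"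
abbreviation "V \<equiv> coord c ` chart_dom c"

lemma time_derivative:
  assumes "\<forall>x\<in>I \<times> V. (g has_derivative g' x) (at x within I \<times> V)"
    and "t \<in> I" "y \<in> V"
  shows "((\<lambda>s. g (s, y)) has_vector_derivative g' (t, y) (1, 0)) (at t within I)"
  using directional_derivative[of "I \<times> V" g g' I "(0, y)" "(1, 0)" t] assms by simp

lemma space_derivative:
  assumes "\<forall>x\<in>I \<times> V. (g has_derivative g' x) (at x within I \<times> V)"
    and "t \<in> I" and "\<And>q. q \<in> chart_dom c \<Longrightarrow> h q = g (t, coord c q)"
  shows "has_partial c i h (g' (t, coord c p) (0, axis i 1)) p"
proof (rule has_partialI[where Y = "\<lambda>y. g (t, y)"])
  show "((\<lambda>s. g (t, coord c p + s *\<^sub>R axis i 1)) has_vector_derivative g' (t, coord c p) (0, axis i 1))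
      (at 0 within coord_line i)"
    using directional_derivative[of "I \<times> V" g g' "coord_line i" "(t, coord c p)" "(0, axis i 1)" 0]
      assms(1,2) zero_in_coord_line by (simp add: coord_line_def)
qed (rule assms(3))

text \<open>First derivatives must be known on the whole chart before they can be differentiated
  again at \<open>p\<close>.\<close>

lemma at_other_point: "q \<in> chart_dom c \<Longrightarrow> C2_family_point c q T F f' f''"
  using inj open_image f' f'' cont by unfold_locales blast+

lemma position_time:
  assumes "t \<in> I" "q \<in> chart_dom c"
  shows "((\<lambda>s. F s q) has_vector_derivative f' (t, coord c q) (1, 0)) (at t within I)"
  using time_derivative[of "\<lambda>(t, x). F t (chart_inv c x)" f' t "coord c q", OF f'] assms by simp

lemma velocity_eq:
  assumes "t \<in> I" "q \<in> chart_dom c"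
  shows "velocity T F t q = f' (t, coord c q) (1, 0)"
  unfolding velocity_def
  by (rule vector_derivative_within[OF at_within_time_interval_nonbot[OF assms(1)] position_time[OF assms]])

lemma position_space: "t \<in> I \<Longrightarrow> has_partial c i (F t) (f' (t, coord c p) (0, axis i 1)) p"
  by (rule space_derivative[OF f']) simp_all

lemma partial_position:
  assumes "t \<in> I" "q \<in> chart_dom c"
  shows "partial c i (F t) q = f' (t, coord c q) (0, axis i 1)"
  using C2_family_point.position_space[OF at_other_point[OF assms(2)] assms(1)]
  by (rule has_partial_imp_partial)

lemma position_derivative:
  assumes "t \<in> I"
  shows "((F t \<circ> chart_inv c) has_derivative (\<lambda>h. f' (t, coord c p) (0, h))) (at (coord c p))"
proof -
  have V: "coord c p \<in> V" using p_in by simp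
  have D: "((\<lambda>(t, x). F t (chart_inv c x)) has_derivative f' (t, coord c p)) (at (t, coord c p) within I \<times> V)"
    using f' assms V by blast
  have "(Pair t has_derivative (\<lambda>h. (0, h))) (at (coord c p) within V)"
    by (auto intro!: derivative_eq_intros)
  from has_derivative_in_compose[OF this has_derivative_subset[OF D]] assms
  have "((\<lambda>x. F t (chart_inv c x)) has_derivative (\<lambda>h. f' (t, coord c p) (0, h))) (at (coord c p) within V)"
    by (simp add: image_subset_iff)
  then show ?thesis by (simp add: at_within_open[OF V open_image] o_def)
qed

text \<open>Translates injectivity of the differential into independence of the coordinate tangent
  vectors.\<close>

lemma position_derivative_sum:
  assumes "t \<in> I"
  shows "f' (t, coord c p) (0, h) = (\<Sum>i\<in>UNIV. h $ i *\<^sub>R partial c i (F t) p)"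
proof -
  have lin: "linear (\<lambda>h. f' (t, coord c p) (0, h))"
    by (rule has_derivative_linear[OF position_derivative[OF assms]])
  have "f' (t, coord c p) (0, h) = f' (t, coord c p) (0, \<Sum>i\<in>UNIV. h $ i *\<^sub>R axis i 1)"
    using basis_expansion[of h] by (simp add: scalar_mult_eq_scaleR)
  also have "\<dots> = (\<Sum>i\<in>UNIV. h $ i *\<^sub>R f' (t, coord c p) (0, axis i 1))"
    by (simp add: linear_sum[OF lin] linear_scale[OF lin])
  finally show ?thesis by (simp add: partial_position[OF assms p_in])
qed

lemma velocity_time:
  assumes "t \<in> I"
  shows "((\<lambda>s. velocity T F s p) has_vector_derivative acceleration T F t p) (at t within I)"
proof -
  have "((\<lambda>s. velocity T F s p) has_vector_derivative f'' (1, 0) (t, coord c p) (1, 0)) (at t within I)"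
    by (rule has_vector_derivative_transform[OF assms _ time_derivative[OF f'' assms]])
      (use p_in in \<open>simp_all add: velocity_eq\<close>)
  with vector_derivative_within[OF at_within_time_interval_nonbot[OF assms] this] show ?thesis
    by (simp add: acceleration_def)
qed

lemma velocity_space:
  assumes "t \<in> I"
  shows "has_partial c i (velocity T F t) (f'' (1, 0) (t, coord c p) (0, axis i 1)) p"
  by (rule space_derivative[OF f'' assms]) (simp_all add: velocity_eq assms)

lemma second_partial_position:
  assumes "t \<in> I"
  shows "has_partial c i (partial c j (F t)) (f'' (0, axis j 1) (t, coord c p) (0, axis i 1)) p"
  by (rule space_derivative[OF f'' assms]) (simp_all add: partial_position assms)

text \<open>Nonnegative time components make the parallelogram point forward in time, so it stays in
  the domain even when \<open>t = 0\<close>; the upper bounds only control its size.\<close>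

lemma f''_symmetric:
  assumes "t \<in> I" "0 \<le> a" "0 \<le> b" "a + b \<le> 1" "norm y \<le> 1" "norm z \<le> 1"
  shows "f'' (a, y) (t, coord c p) (b, z) = f'' (b, z) (t, coord c p) (a, y)"
proof -
  obtain d where d: "0 < d" "{t..t + d} \<subseteq> I"
    using time_interval_right[OF assms(1)] .
  obtain e where e: "0 < e" "ball (coord c p) e \<subseteq> V"
    using open_image p_in by (metis open_contains_ball imageI)
  \<comment> \<open>The time displacement is at most \<open>\<delta>\<close> because
    \<open>a + b \<le> 1\<close>; the spatial one is at most \<open>2 * \<delta>\<close>, which
    \<open>e / 3\<close> keeps below \<open>e\<close>.\<close>
  define \<delta> where "\<delta> = min d (e / 3)"
  have \<delta>: "0 < \<delta>" "\<delta> \<le> d" "\<delta> < e / 2" using d e by (auto simp: \<delta>_def)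
  show ?thesis
  proof (rule second_derivative_symmetric_within[OF f' f'' cont \<delta>(1)])
    fix s r assume sr: "s \<in> {0..\<delta>}" "r \<in> {0..\<delta>}"
    have "s * a + r * b \<le> \<delta> * a + \<delta> * b"
      using sr assms(2,3) by (intro add_mono mult_right_mono) auto
    also have "\<dots> \<le> \<delta>"
      using assms(4) \<delta>(1) mult_left_mono[of "a + b" 1 \<delta>] by (simp add: algebra_simps)
    finally have "t + (s * a + r * b) \<in> {t..t + d}" using sr assms(2,3) \<delta> by auto
    with d(2) have 1: "t + (s * a + r * b) \<in> I" by blast
    have "norm (s *\<^sub>R y + r *\<^sub>R z) \<le> s * norm y + r * norm z"
      using sr by (intro norm_triangle_le) auto
    also have "\<dots> \<le> \<delta> * 1 + \<delta> * 1"
      using sr assms(5,6) by (intro add_mono mult_mono) auto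
    also have "\<dots> < e" using \<delta> by simp
    finally have "norm (s *\<^sub>R y + r *\<^sub>R z) < e" .
    moreover have "dist (coord c p) (coord c p + a) = norm a" for a
      by (simp add: dist_norm)
    ultimately have "coord c p + (s *\<^sub>R y + r *\<^sub>R z) \<in> ball (coord c p) e"
      by (simp only: mem_ball)
    with e(2) have "coord c p + (s *\<^sub>R y + r *\<^sub>R z) \<in> V" by blast
    with 1 show "(t, coord c p) + s *\<^sub>R (a, y) + r *\<^sub>R (b, z) \<in> I \<times> V"
      by (simp add: add.assoc)
  qed
qed

lemma second_partial_symmetric:
  "t \<in> I \<Longrightarrow> f'' (0, axis j 1) (t, coord c p) (0, axis i 1) = f'' (0, axis i 1) (t, coord c p) (0, axis j 1)"
  by (rule f''_symmetric) (simp_all add: norm_axis_1)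

text \<open>Time and space derivatives commute, by symmetry of \<open>f''\<close> in one time and
  one coordinate direction.\<close>

lemma partial_position_time:
  assumes "t \<in> I"
  shows "((\<lambda>s. partial c i (F s) p) has_vector_derivative partial c i (velocity T F t) p) (at t within I)"
proof -
  have "((\<lambda>s. partial c i (F s) p) has_vector_derivative f'' (0, axis i 1) (t, coord c p) (1, 0)) (at t within I)"
    by (rule has_vector_derivative_transform[OF assms _ time_derivative[OF f'' assms]])
      (use p_in in \<open>simp_all add: partial_position\<close>)
  moreover have "f'' (0, axis i 1) (t, coord c p) (1, 0) = f'' (1, 0) (t, coord c p) (0, axis i 1)"
    by (rule f''_symmetric[OF assms]) (simp_all add: norm_axis_1)
  ultimately show ?thesis
    by (simp add: has_partial_imp_partial[OF velocity_space[OF assms]])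
qed

end

lemma has_partial_of_C1_family:
  fixes c :: "('a, 'n::finite) chart" and \<nu> :: "real \<Rightarrow> 'a \<Rightarrow> real^'m::finite"
  assumes "chart_point c p" and C1: "Ck_family 1 A T \<nu>" and c: "c \<in> A" and t: "t \<in> time_interval T"
  shows "has_partial c i (\<nu> t) (partial c i (\<nu> t) p) p"
proof -
  interpret chart_point c p by fact
  let ?D = "time_interval T \<times> coord c ` chart_dom c"
  let ?g = "\<lambda>(t, x). \<nu> t (chart_inv c x)"
  have "Ck_on_nat (Suc 0) ?D ?g"
    using C1 c unfolding Ck_family_def Ck_on_def one_enat_def
    by (simp del: Ck_on_nat.simps)
  then obtain g' where g': "\<forall>x\<in>?D. (?g has_derivative g' x) (at x within ?D)"
    by auto
  have "has_partial c i (\<nu> t) (g' (t, coord c p) (0, axis i 1)) p"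
  proof (rule has_partialI[where Y = "\<lambda>y. \<nu> t (chart_inv c y)"])
    show "((\<lambda>s. \<nu> t (chart_inv c (coord c p + s *\<^sub>R axis i 1))) has_vector_derivative
        g' (t, coord c p) (0, axis i 1)) (at 0 within coord_line i)"
      using directional_derivative[of ?D ?g g' "coord_line i" "(t, coord c p)" "(0, axis i 1)" 0, OF g']
        t zero_in_coord_line by (simp add: coord_line_def)
  qed simp
  with has_partial_imp_partial[OF this] show ?thesis by simp
qed

section \<open>The balance law\<close>

text \<open>The two terms of the derivative of the metric have equal traces against the symmetric
  inverse; the resulting 2 cancels the 1/2 from the square root.\<close>

lemma (in hypersurface_point) volume_form_time_derivative:
  assumes f: "f = F t"
    and E': "\<And>i. ((\<lambda>s. partial c i (F s) p) has_vector_derivative dv i) (at t within I)"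
  shows "((\<lambda>s. volume_form c (F s) p W) has_real_derivative
      volume_form c f p W * (\<Sum>i\<in>UNIV. \<Sum>j\<in>UNIV. R $ i $ j * (dv j \<bullet> E i))) (at t within I)"
proof -
  define G' :: "real^'n^'n" where "G' = (\<chi> i j. E i \<bullet> dv j + dv i \<bullet> E j)"
  have G': "((\<lambda>s. metric c (F s) p $ i $ j) has_real_derivative G' $ i $ j) (at t within I)" for i j
    using bounded_bilinear.has_vector_derivative[OF bounded_bilinear_inner E' E', of i j]
    by (simp add: metric_def G'_def f has_real_derivative_iff_has_vector_derivative)
  have "(\<Sum>i\<in>UNIV. \<Sum>j\<in>UNIV. G' $ i $ j * R $ j $ i)
      = (\<Sum>i\<in>UNIV. \<Sum>j\<in>UNIV. R $ i $ j * (dv j \<bullet> E i)) + (\<Sum>i\<in>UNIV. \<Sum>j\<in>UNIV. R $ j $ i * (dv i \<bullet> E j))"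
    unfolding sum.distrib[symmetric]
    by (intro sum.cong refl) (simp add: G'_def metric_inv_sym algebra_simps inner_commute)
  also have "(\<Sum>i\<in>UNIV. \<Sum>j\<in>UNIV. R $ j $ i * (dv i \<bullet> E j)) = (\<Sum>i\<in>UNIV. \<Sum>j\<in>UNIV. R $ i $ j * (dv j \<bullet> E i))"
    by (rule sum.swap)
  finally have tr: "(\<Sum>i\<in>UNIV. \<Sum>j\<in>UNIV. G' $ i $ j * R $ j $ i)
      = 2 * (\<Sum>i\<in>UNIV. \<Sum>j\<in>UNIV. R $ i $ j * (dv j \<bullet> E i))" by simp
  have "((\<lambda>s. sqrt (det (metric c (F s) p))) has_real_derivative
      sqrt (det (metric c f p)) * (\<Sum>i\<in>UNIV. \<Sum>j\<in>UNIV. R $ i $ j * (dv j \<bullet> E i))) (at t within I)"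
    using sqrt_det_has_derivative[of "\<lambda>s. metric c (F s) p" G' t I, OF G'] metric_invertible tr
    by (simp add: f metric_inv_def)
  from DERIV_cmult_right[OF this, of "det W"] show ?thesis
    by (simp add: volume_form_def mult_ac)
qed

theorem proposition4p3:
  fixes M :: "'a topology"
    and A Ori :: "('a, 'n::finite) chart set"
    and T :: ereal
    and r :: enat
    and F \<nu> :: "real \<Rightarrow> 'a \<Rightarrow> real^'m::finite"
    and n :: nat
  assumes "n = CARD('n)" and "CARD('m) = n + 1"
    and "smooth_manifold M A" and "orientation M A Ori"
    and "2 \<le> r" and "Ck_family r A T F"
    and "\<forall>t\<in>time_interval T. immersion A (F t)"
    and "unit_normal A T F \<nu>"
    and "HMCF A T F \<nu>"
  shows "\<forall>t\<in>time_interval T. \<forall>c\<in>Ori. \<forall>p\<in>chart_dom c. \<forall>V :: real^'n^'n.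
     ((\<lambda>s. (velocity T F s p \<bullet> F s p) * volume_form c (F s) p V) has_real_derivative
        divergence c (F t)
            (\<lambda>q. \<chi> k. (real n - energy_density n T F t q) * (F t q \<bullet> partial c k (F t) q)) p
          * volume_form c (F t) p V
        + ((real n + 2) * energy_density n T F t p - real n * (real n + 1))
          * volume_form c (F t) p V)
       (at t within time_interval T)"
proof (intro ballI allI)
  fix t c p and W :: "real^'n^'n"
  assume t: "t \<in> time_interval T" and "c \<in> Ori" and p: "p \<in> chart_dom c"
  then have c: "c \<in> A" using assms(4) by (auto simp: orientation_def)
  then have "is_chart M c" using assms(3) by (auto simp: smooth_manifold_def)
  then have "open (coord c ` chart_dom c)" "inj_on (coord c) (chart_dom c)"
    by (auto simp: is_chart_def homeomorphic_map_def topspace_subtopology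
        dest!: homeomorphic_imp_injective_map openin_subset simp: Int_absorb1)
  with p interpret chart_point c p by unfold_locales
  have "enat 2 \<le> r" using assms(5) by (simp add: numeral_eq_enat)
  then have "Ck_on_nat 2 (time_interval T \<times> coord c ` chart_dom c) (\<lambda>(t, x). F t (chart_inv c x))"
    using assms(6) c by (simp add: Ck_family_def Ck_on_def)
  then obtain f' f'' where fs: "C2_family_point c p T F f' f''"
    using chart_point_axioms
    by (elim Ck_on_nat_2_obtain) (auto simp: C2_family_point_def C2_family_point_axioms_def)
  then interpret C2_family_point c p T F f' f'' .
  let ?v = "velocity T F t" and ?X = "F t p" and ?N = "\<nu> t p"
  let ?e = "energy_density n T F t p"
  have indep: "independent_family (\<lambda>i. partial c i (F t) p)"
  proof -
    have "frechet_derivative (F t \<circ> chart_inv c) (at (coord c p)) = (\<lambda>h. f' (t, coord c p) (0, h))"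
      using frechet_derivative_at[OF position_derivative[OF t]] by simp
    then have "inj (\<lambda>h. f' (t, coord c p) (0, h))"
      using assms(7) t c p by (metis immersion_def)
    then show ?thesis
      using linear_injective_0[OF has_derivative_linear[OF position_derivative[OF t]]]
      by (simp add: position_derivative_sum[OF t] independent_family_def)
  qed
  have normal: "norm (\<nu> t q) = 1" "\<nu> t q \<bullet> partial c i (F t) q = 0" if "q \<in> chart_dom c" for q i
    using assms(8) t c that by (auto simp: unit_normal_def)
  have C1: "Ck_family 1 A T \<nu>" using assms(8) by (simp add: unit_normal_def)
  interpret hypersurface_point c p "F t" "\<nu> t" "\<lambda>i j. f'' (0, axis j 1) (t, coord c p) (0, axis i 1)"
  proof unfold_locales
    show "CARD('m) = CARD('n) + 1" using assms(1,2) by simp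
    show "has_partial c i (\<nu> t) (partial c i (\<nu> t) p) p" for i
      by (rule has_partial_of_C1_family[OF chart_point_axioms C1 c t])
  qed (use normal p indep second_partial_position[OF t] second_partial_symmetric[OF t] in auto)
  define dv where "dv i = partial c i ?v p" for i
  have dv: "has_partial c i ?v (dv i) p" for i
    using velocity_space[OF t] has_partial_imp_partial[OF velocity_space[OF t]] by (simp add: dv_def)
  have dF: "has_partial c i (F t) (E i) p" for i
    using position_space[OF t] has_partial_imp_partial[OF position_space[OF t]] by simp
  \<comment> \<open>The factor 1/2 in the energy density cancels the 2 from differentiating the
    squared speed.\<close>
  have de: "has_partial c i (energy_density n T F t) (?v p \<bullet> dv i) p" for i
  proof -
    have "has_partial c i (\<lambda>q. ?v q \<bullet> ?v q) (?v p \<bullet> dv i + dv i \<bullet> ?v p) p"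
      by (rule has_partial_inner[OF dv dv])
    then have "((\<lambda>s. 1/2 * (?v (chart_inv c (coord c p + s *\<^sub>R axis i 1)) \<bullet> ?v (chart_inv c (coord c p + s *\<^sub>R axis i 1)) + real n))
       has_real_derivative 1/2 * (?v p \<bullet> dv i + dv i \<bullet> ?v p + 0)) (at 0)"
      unfolding has_partial_def has_real_derivative_iff_has_vector_derivative[symmetric]
      by (intro DERIV_cmult DERIV_add DERIV_const)
    then show ?thesis
      by (simp add: has_partial_def has_real_derivative_iff_has_vector_derivative energy_density_def
          power2_norm_eq_inner inner_commute)
  qed
  define tr where "tr = (\<Sum>i\<in>UNIV. \<Sum>j\<in>UNIV. R $ i $ j * (dv j \<bullet> E i))"
  define H where "H = mean_curvature c (F t) (\<nu> t) p"
  define S where "S = tang_velocity c T F t"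
  define Sup where "Sup = raise c (F t) S p"
  define grad where "grad = gradient c (F t) (energy_density n T F t) p"
  define \<sigma> where "\<sigma> = sigma T F \<nu> t p"
  have div_S: "divergence c (F t) S p = tr + \<sigma> * H"
  proof -
    have "S = (\<lambda>q. \<chi> k. ?v q \<bullet> partial c k (F t) q)"
      by (simp add: S_def tang_velocity_def fun_eq_iff)
    then show ?thesis
      using divergence_tangential[OF dv] by (simp add: tr_def \<sigma>_def sigma_def H_def)
  qed
  have acc: "acceleration T F t p =
      ((?e - S p \<bullet> Sup) * H - \<sigma> * (tr + \<sigma> * H)) *\<^sub>R ?N
      + (\<Sum>k\<in>UNIV. ((\<sigma> * H - (tr + \<sigma> * H)) * Sup $ k - grad $ k) *\<^sub>R E k)"
    using assms(9) t c p unfolding HMCF_def Let_def assms(1)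
    by (simp add: S_def Sup_def grad_def \<sigma>_def H_def div_S[unfolded S_def \<sigma>_def H_def, symmetric] assms(1))
  have Sup: "Sup $ k = (\<Sum>l\<in>UNIV. R $ k $ l * (?v p \<bullet> E l))" for k
    by (simp add: Sup_def raise_def S_def tang_velocity_def)
  have grad: "grad $ k = (\<Sum>l\<in>UNIV. R $ k $ l * (?v p \<bullet> dv l))" for k
    by (simp add: grad_def gradient_def raise_def has_partial_imp_partial[OF de])
  \<comment> \<open>\<open>Q\<close> pairs the position with the tangential velocity,
    \<open>K\<close> pairs it with the gradient of \<open>e\<close>. \<open>K\<close> occurs both in
    the acceleration and in the flux.\<close>
  define Q where "Q = (\<Sum>k\<in>UNIV. Sup $ k * (E k \<bullet> ?X))"
  define K where "K = (\<Sum>k\<in>UNIV. grad $ k * (E k \<bullet> ?X))"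
  have aX: "acceleration T F t p \<bullet> ?X = ((?e - S p \<bullet> Sup) * H - \<sigma> * (tr + \<sigma> * H)) * (?N \<bullet> ?X)
      + (\<sigma> * H - (tr + \<sigma> * H)) * Q - K"
    unfolding acc by (simp add: inner_add_left inner_sum_left Q_def K_def sum_subtractf
        sum_distrib_left left_diff_distrib mult.assoc sum_negf)
  have vX: "?v p \<bullet> ?X = \<sigma> * (?N \<bullet> ?X) + Q"
    using inner_decomposition[of "?v p" ?X] by (simp add: \<sigma>_def sigma_def Q_def Sup)
  have vv: "?v p \<bullet> ?v p = \<sigma> * \<sigma> + S p \<bullet> Sup"
    using inner_decomposition[of "?v p" "?v p"]
    by (simp add: \<sigma>_def sigma_def Sup inner_vec_def S_def tang_velocity_def inner_commute mult.commute)
  have e: "?v p \<bullet> ?v p = 2 * ?e - n"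
    by (simp add: energy_density_def power2_norm_eq_inner field_simps)
  \<comment> \<open>The flux is the divergence of the tangential part of
    \<open>X = (n - e) F\<close>. Differentiating \<open>F\<close> yields the trace of the identity,
    which is \<open>n\<close>; differentiating \<open>- e\<close> yields \<open>- K\<close>.\<close>
  have "has_partial c i (\<lambda>q. real n - energy_density n T F t q) (- (?v p \<bullet> dv i)) p" for i
    using has_vector_derivative_diff[OF has_vector_derivative_const de[unfolded has_partial_def]]
    by (simp add: has_partial_def)
  then have "has_partial c i (\<lambda>q. (real n - energy_density n T F t q) *\<^sub>R F t q)
      ((real n - ?e) *\<^sub>R E i + (- (?v p \<bullet> dv i)) *\<^sub>R ?X) p" for i
    by (rule has_partial_scaleR[OF _ dF])
  from divergence_tangential[OF this]
  have "divergence c (F t) (\<lambda>q. \<chi> k. (real n - energy_density n T F t q) * (F t q \<bullet> partial c k (F t) q)) p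
      = (\<Sum>i\<in>UNIV. \<Sum>j\<in>UNIV. R $ i $ j * (((real n - ?e) *\<^sub>R E j + (- (?v p \<bullet> dv j)) *\<^sub>R ?X) \<bullet> E i))
        + (real n - ?e) * (?X \<bullet> ?N) * H"
    by (simp add: H_def)
  also have "(\<Sum>i\<in>UNIV. \<Sum>j\<in>UNIV. R $ i $ j * (((real n - ?e) *\<^sub>R E j + (- (?v p \<bullet> dv j)) *\<^sub>R ?X) \<bullet> E i))
      = (real n - ?e) * (\<Sum>i\<in>UNIV. \<Sum>j\<in>UNIV. R $ i $ j * (E j \<bullet> E i)) - K"
    by (simp add: K_def grad inner_add_left inner_diff_left algebra_simps sum.distrib sum_subtractf
        sum_distrib_left inner_commute)
  also have "(\<Sum>i\<in>UNIV. \<Sum>j\<in>UNIV. R $ i $ j * (E j \<bullet> E i)) = real n"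
    by (simp add: metric_inv_mult assms(1))
  finally have div: "divergence c (F t)
      (\<lambda>q. \<chi> k. (real n - energy_density n T F t q) * (F t q \<bullet> partial c k (F t) q)) p
      = (real n - ?e) * n - K + (real n - ?e) * (?N \<bullet> ?X) * H"
    by (simp add: inner_commute)
  have vol: "((\<lambda>s. volume_form c (F s) p W) has_real_derivative volume_form c (F t) p W * tr)
      (at t within time_interval T)"
    unfolding tr_def
    by (rule volume_form_time_derivative[of F t, OF refl]) (simp add: dv_def partial_position_time[OF t])
  have "((\<lambda>s. velocity T F s p \<bullet> F s p) has_real_derivative
      ?v p \<bullet> ?v p + acceleration T F t p \<bullet> ?X) (at t within time_interval T)"
    using bounded_bilinear.has_vector_derivative[OF bounded_bilinear_inner velocity_time[OF t] position_time[OF t p]]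
    by (simp add: has_real_derivative_iff_has_vector_derivative velocity_eq[OF t p])
  from DERIV_mult[OF this vol]
  have D: "((\<lambda>s. (velocity T F s p \<bullet> F s p) * volume_form c (F s) p W) has_real_derivative
      (?v p \<bullet> ?v p + acceleration T F t p \<bullet> ?X) * volume_form c (F t) p W
      + volume_form c (F t) p W * tr * (?v p \<bullet> ?X)) (at t within time_interval T)" .
  have S2: "S p \<bullet> Sup = 2 * ?e - n - \<sigma> * \<sigma>" using vv e by simp
  \<comment> \<open>With \<open>S2\<close> the normal coefficient of the acceleration becomes
    \<open>(n - e) * H - \<sigma> * tr\<close> and the coefficient of \<open>Q\<close> is
    \<open>- tr\<close>, so all terms with \<open>tr\<close> cancel against
    \<open>tr * (?v p \<bullet> ?X)\<close>. What remains is
    \<open>2 * e - n = (n - e) * n + (n + 2) * e - n * (n + 1)\<close>.\<close>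
  have "?v p \<bullet> ?v p + acceleration T F t p \<bullet> ?X + tr * (?v p \<bullet> ?X)
      = ((real n - ?e) * n - K + (real n - ?e) * (?N \<bullet> ?X) * H) + ((real n + 2) * ?e - real n * (real n + 1))"
    unfolding aX vX e S2 by algebra
  then have "(?v p \<bullet> ?v p + acceleration T F t p \<bullet> ?X) * volume_form c (F t) p W
      + volume_form c (F t) p W * tr * (?v p \<bullet> ?X)
      = ((real n - ?e) * n - K + (real n - ?e) * (?N \<bullet> ?X) * H) * volume_form c (F t) p W
        + ((real n + 2) * ?e - real n * (real n + 1)) * volume_form c (F t) p W"
    by algebra
  with D show "((\<lambda>s. (velocity T F s p \<bullet> F s p) * volume_form c (F s) p W) has_real_derivative
        divergence c (F t)
            (\<lambda>q. \<chi> k. (real n - energy_density n T F t q) * (F t q \<bullet> partial c k (F t) q)) p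
          * volume_form c (F t) p W
        + ((real n + 2) * energy_density n T F t p - real n * (real n + 1))
          * volume_form c (F t) p W)
       (at t within time_interval T)"
    unfolding div by simp
qed

end
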